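(* Let $(X_n)_{n\ge1}$ and $(Y_n)_{n\ge0}$ be two sequences of independent identically distributed random variables, independent of each other, such that $X_1$ is uniformly distributed on $\{(1,0),(-1,0),(0,1),(0,-1)\}$ and $Y_0$ is uniformly distributed on $(0,1)^2$. Let $S_0=0$, $S_n=\sum_{k=1}^nX_k$, $M_n=S_n+Y_n$ for $n\ge0$, and for $\varepsilon>0$ let $$\tau_\varepsilon=\min\{m\ge1:|M_m-M_0|<\varepsilon\},$$ where $|\cdot|$ is the Euclidean norm on $\mathbb{R}^2$. Let $\lambda$ be the Lebesgue measure on $\mathbb{R}^2$ and $B(x,\varepsilon)$ the open Euclidean ball of center $x$ and radius $\varepsilon$. Then for all $t\ge0$, $$\lim_{\varepsilon\to0}\mathbb{P}\left(\lambda(B(M_0,\varepsilon))\log\tau_\varepsilon\le t\right)=\frac{1}{1+\frac{\pi}{t}},$$ where the right-hand side is read as $0$ when $t=0$. *)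

theory Defs
  imports "HOL-Probability.Probability"
begin

(* A sequence may start at any index, so the index set I is a parameter. *)
definition (in prob_space) iid_vars :: "'b measure \<Rightarrow> (nat \<Rightarrow> 'a \<Rightarrow> 'b) \<Rightarrow> nat set \<Rightarrow> bool" where
  "iid_vars N Z I \<longleftrightarrow>
     indep_vars (\<lambda>_. N) Z I \<and> (\<forall>i\<in>I. \<forall>j\<in>I. distr M N (Z i) = distr M N (Z j))"

(* Independence of two whole sequences, seen as random elements of the product spaces. *)
definition (in prob_space) indep_seqs ::
  "'b measure \<Rightarrow> (nat \<Rightarrow> 'a \<Rightarrow> 'b) \<Rightarrow> nat set \<Rightarrow> 'b measure \<Rightarrow> (nat \<Rightarrow> 'a \<Rightarrow> 'b) \<Rightarrow> nat set \<Rightarrow> bool" where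
  "indep_seqs N Z I N' Z' J \<longleftrightarrow>
     indep_var (Pi\<^sub>M I (\<lambda>_. N)) (\<lambda>\<omega>. \<lambda>i\<in>I. Z i \<omega>) (Pi\<^sub>M J (\<lambda>_. N')) (\<lambda>\<omega>. \<lambda>j\<in>J. Z' j \<omega>)"

(* The norm on real \<times> real is the Euclidean one, so this type serves as the Euclidean plane. *)
definition unit_steps :: "(real \<times> real) set" where
  "unit_steps = {(1, 0), (-1, 0), (0, 1), (0, -1)}"

definition walk :: "(nat \<Rightarrow> 'a \<Rightarrow> real \<times> real) \<Rightarrow> nat \<Rightarrow> 'a \<Rightarrow> real \<times> real" where
  "walk X n \<omega> = (\<Sum>k=1..n. X k \<omega>)"

definition perturbed_walk ::
  "(nat \<Rightarrow> 'a \<Rightarrow> real \<times> real) \<Rightarrow> (nat \<Rightarrow> 'a \<Rightarrow> real \<times> real) \<Rightarrow> nat \<Rightarrow> 'a \<Rightarrow> real \<times> real" where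
  "perturbed_walk X Y n \<omega> = walk X n \<omega> + Y n \<omega>"

(* In enat, Inf {} = \<infinity>: the return time is infinite when there is no return. *)
definition return_time :: "(nat \<Rightarrow> 'a \<Rightarrow> real \<times> real) \<Rightarrow> real \<Rightarrow> 'a \<Rightarrow> enat" where
  "return_time W \<epsilon> \<omega> = Inf {enat m | m. m \<ge> 1 \<and> norm (W m \<omega> - W 0 \<omega>) < \<epsilon>}"

(* Natural logarithm with log \<infinity> = \<infinity>; only used for arguments \<ge> 1. *)
definition ln_enat :: "enat \<Rightarrow> ereal" where
  "ln_enat n = (case n of enat m \<Rightarrow> ereal (ln (real m)) | \<infinity> \<Rightarrow> \<infinity>)"

end

theory Submission
  imports Defs "HOL-Real_Asymp.Real_Asymp"
begin

text \<open>
  Away from the boundary of the unit square, the perturbed walk is within distance \<open>\<epsilon>\<close> of its start at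
  time m iff the simple random walk is at the origin and a uniform point falls in a ball of measure
  \<open>p = \<pi> \<epsilon>\<^sup>2\<close>. So the probability \<open>w n\<close> of no return up to time n is the expectation of \<open>(1 - p)\<close> to
  the number of zeros of the walk. Decomposing at the last return gives
  \<open>1 = w n + p (\<Sum>k=1..n. u k * w (n - k))\<close> with u k the probability that the walk is at the origin
  at time k. As w is decreasing and the partial sums G of u are \<open>ln n / \<pi> + O(1)\<close> (u is the square of
  the central binomial probability, and Wallis' product applies), this equation at the times n and 2n
  pins \<open>w n\<close> between \<open>(1 - 3p) / (1 + p G n)\<close> and \<open>1 / (1 + p G n)\<close>. At \<open>n = \<lfloor>exp (t / p)\<rfloor>\<close> both tend
  to \<open>1 / (1 + t / \<pi>)\<close>.
\<close>

subsection \<open>Visits of the simple random walk to the origin\<close>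

text \<open>The probability that the simple random walk started at x is at the origin at time n.\<close>
primrec origin_prob :: "nat \<Rightarrow> real \<times> real \<Rightarrow> real" where
  "origin_prob 0 x = (if x = 0 then 1 else 0)"
| "origin_prob (Suc n) x = (\<Sum>e\<in>unit_steps. origin_prob n (x + e)) / 4"

text \<open>The expectation of q to the number of visits to the origin at times 1 to n of the simple
  random walk started at x.\<close>
primrec zeros_gf :: "real \<Rightarrow> nat \<Rightarrow> real \<times> real \<Rightarrow> real" where
  "zeros_gf q 0 x = 1"
| "zeros_gf q (Suc n) x =
     (\<Sum>e\<in>unit_steps. (if x + e = 0 then q else 1) * zeros_gf q n (x + e)) / 4"

text \<open>The probability that n fair steps of size 1 on the line add up to s.\<close>
primrec coin_prob :: "nat \<Rightarrow> real \<Rightarrow> real" where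
  "coin_prob 0 s = (if s = 0 then 1 else 0)"
| "coin_prob (Suc n) s = (coin_prob n (s - 1) + coin_prob n (s + 1)) / 2"

text \<open>The Green function at the origin, truncated at time n: the expected number of returns.
  Time 0 is left out because only visits at times at least 1 count as returns.\<close>

definition green :: "nat \<Rightarrow> real" where
  "green n = (\<Sum>k=1..n. origin_prob k 0)"

lemma sum_unit_steps:
  "(\<Sum>e\<in>unit_steps. f e) = f (1, 0) + f (-1, 0) + f (0, 1) + (f (0, -1) :: real)"
  by (simp add: unit_steps_def)

lemma origin_prob_nonneg: "0 \<le> origin_prob n x"
  by (induction n arbitrary: x) (auto intro!: sum_nonneg)

lemma zeros_gf_bounds:
  assumes "0 \<le> q" "q \<le> 1"
  shows "0 \<le> zeros_gf q n x \<and> zeros_gf q n x \<le> 1"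
proof (induction n arbitrary: x)
  case (Suc n)
  define h where "h y = (if y = 0 then q else 1) * zeros_gf q n y" for y
  have h: "0 \<le> h y" "h y \<le> 1" for y
    using Suc[of y] assms by (auto simp: h_def intro: mult_le_one)
  have "zeros_gf q (Suc n) x = (h (x + (1, 0)) + h (x + (-1, 0)) + h (x + (0, 1)) + h (x + (0, -1))) / 4"
    unfolding zeros_gf.simps sum_unit_steps h_def ..
  then show ?case
    using h[of "x + (1, 0)"] h[of "x + (-1, 0)"] h[of "x + (0, 1)"] h[of "x + (0, -1)"]
    by simp
qed simp

text \<open>One more step can only multiply in a further factor from [0,1]; the induction propagates
  this from the bound by 1.\<close>

lemma zeros_gf_Suc_le:
  assumes "0 \<le> q" "q \<le> 1"
  shows "zeros_gf q (Suc n) x \<le> zeros_gf q n x"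
proof (induction n arbitrary: x)
  case 0
  then show ?case using zeros_gf_bounds[OF assms, of "Suc 0" x] by simp
next
  case (Suc n)
  show ?case
    unfolding zeros_gf.simps(2)[of q "Suc n"] zeros_gf.simps(2)[of q n x]
    using Suc assms by (intro divide_right_mono sum_mono mult_left_mono) auto
qed

lemma zeros_gf_antimono:
  assumes "0 \<le> q" "q \<le> 1" "m \<le> n"
  shows "zeros_gf q n x \<le> zeros_gf q m x"
  by (rule lift_Suc_antimono_le[of "\<lambda>n. zeros_gf q n x"]) (use assms zeros_gf_Suc_le in auto)

text \<open>For x = 0 this sorts the paths by the last visit to the origin that is not skipped, when each
  visit is skipped independently with probability q.\<close>
lemma renewal:
  "zeros_gf q n x + (1 - q) * (\<Sum>k=1..n. origin_prob k x * zeros_gf q (n - k) 0) = 1"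
proof (induction n arbitrary: x)
  case (Suc n)
  define R where "R y = (\<Sum>k=1..n. origin_prob k y * zeros_gf q (n - k) 0)" for y
  \<comment> \<open>\<open>origin_prob 0\<close> is the indicator of the origin, so the term k = 0
    survives only for y = 0.\<close>
  have split: "(\<Sum>k\<le>n. origin_prob k y * zeros_gf q (n - k) 0) =
      (if y = 0 then zeros_gf q n y else 0) + R y" for y
    unfolding R_def by (simp add: sum.atMost_shift sum.shift_bounds_Suc_ivl
        atLeast0LessThan[symmetric] sum.atLeast1_atMost_eq)
  \<comment> \<open>Shifting k by one exposes the first step of the walk, so that everything becomes
    an average over the neighbours x + e, where the induction hypothesis applies.\<close>
  have "(\<Sum>k=1..Suc n. origin_prob k x * zeros_gf q (Suc n - k) 0)
      = (\<Sum>k\<le>n. origin_prob (Suc k) x * zeros_gf q (n - k) 0)"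
    by (simp only: One_nat_def sum.atLeast1_atMost_eq lessThan_Suc_atMost diff_Suc_Suc)
  also have "\<dots> = (\<Sum>k\<le>n. \<Sum>e\<in>unit_steps. origin_prob k (x + e) * zeros_gf q (n - k) 0) / 4"
    by (simp add: sum_distrib_right sum_divide_distrib)
  also have "\<dots> = (\<Sum>e\<in>unit_steps. (if x + e = 0 then zeros_gf q n (x + e) else 0) + R (x + e)) / 4"
    by (subst sum.swap) (simp only: split)
  finally have E: "(\<Sum>k=1..Suc n. origin_prob k x * zeros_gf q (Suc n - k) 0)
    = (\<Sum>e\<in>unit_steps. (if x + e = 0 then zeros_gf q n (x + e) else 0) + R (x + e)) / 4" .
  have "zeros_gf q (Suc n) x + (1 - q) * (\<Sum>k=1..Suc n. origin_prob k x * zeros_gf q (Suc n - k) 0)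
    = (\<Sum>e\<in>unit_steps. (if x + e = 0 then q else 1) * zeros_gf q n (x + e)
        + (1 - q) * ((if x + e = 0 then zeros_gf q n (x + e) else 0) + R (x + e))) / 4"
    unfolding E zeros_gf.simps times_divide_eq_right add_divide_distrib[symmetric]
      sum_distrib_left sum.distrib[symmetric] ..
  \<comment> \<open>At x + e = 0 the two parts recombine as q w + (1 - q) w = w; elsewhere there is
    nothing to recombine.\<close>
  also have "\<dots> = (\<Sum>e\<in>unit_steps. zeros_gf q n (x + e) + (1 - q) * R (x + e)) / 4"
    by (intro arg_cong[where f = "\<lambda>s. s / 4"] sum.cong) (auto simp: algebra_simps)
  also have "\<dots> = (\<Sum>e\<in>unit_steps. 1) / 4"
    using Suc unfolding R_def by (intro arg_cong[where f = "\<lambda>s. s / 4"] sum.cong) auto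
  also have "\<dots> = 1" unfolding sum_unit_steps by simp
  finally show ?case .
qed simp

section \<open>Coin-tossing walks and central binomial probabilities\<close>

text \<open>In the rotated coordinates the planar walk is a pair of independent coin-tossing walks.\<close>
lemma origin_prob_eq_coin_prob:
  "origin_prob n (x, y) = coin_prob n (x + y) * coin_prob n (x - y)"
proof (induction n arbitrary: x y)
  case 0
  then show ?case by (auto simp: zero_prod_def)
next
  case (Suc n)
  show ?case
    by (simp add: sum_unit_steps Suc algebra_simps)
qed

lemma coin_prob_eq_0:
  assumes "\<bar>s\<bar> > real n"
  shows "coin_prob n s = 0"
  using assms by (induction n arbitrary: s) auto

text \<open>The position n - 2k is reached by exactly k downward steps; the recursion is Pascal's
  rule.\<close>

lemma coin_prob_binomial: "coin_prob n (real n - 2 * real k) = real (n choose k) / 2 ^ n"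
proof (induction n arbitrary: k)
  case 0
  then show ?case by (cases k) auto
next
  case (Suc n)
  show ?case
  proof (cases k)
    case 0
    \<comment> \<open>Only upward steps lead to n + 1: the other predecessor n + 2 is out of reach
      after n steps.\<close>
    then show ?thesis using Suc[of 0] by (simp add: coin_prob_eq_0)
  next
    case (Suc j)
    have "coin_prob n (real n - 2 * real k) = real (n choose k) / 2 ^ n"
      "coin_prob n (real n - 2 * real j) = real (n choose j) / 2 ^ n"
      using Suc.IH by auto
    then show ?thesis using \<open>k = Suc j\<close> by (simp add: algebra_simps add_divide_distrib)
  qed
qed

text \<open>Parity: each step changes the position by an odd amount. This is what makes odd times
  drop out of the Green function.\<close>

lemma coin_prob_neq_0D:
  assumes "coin_prob n s \<noteq> 0"
  shows "\<exists>k::int. s = real n + 2 * of_int k"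
  using assms
proof (induction n arbitrary: s)
  case (Suc n)
  then consider "coin_prob n (s - 1) \<noteq> 0" | "coin_prob n (s + 1) \<noteq> 0" by force
  then show ?case
  proof cases
    case 1
    then obtain k :: int where "s - 1 = real n + 2 * of_int k" using Suc.IH by blast
    then show ?thesis by (intro exI[of _ k]) simp
  next
    case 2
    then obtain k :: int where "s + 1 = real n + 2 * of_int k" using Suc.IH by blast
    then show ?thesis by (intro exI[of _ "k - 1"]) simp
  qed
qed (auto split: if_splits intro: exI[of _ 0])

text \<open>The probability that 2j fair coin steps balance out, of order 1 / sqrt (pi j).\<close>

definition central_prob :: "nat \<Rightarrow> real" where
  "central_prob j = real (2 * j choose j) / 4 ^ j"

lemma origin_prob_even: "origin_prob (2 * j) 0 = (central_prob j)\<^sup>2"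
  using coin_prob_binomial[of "2 * j" j] origin_prob_eq_coin_prob[of "2 * j" 0 0]
  by (simp add: central_prob_def zero_prod_def power2_eq_square power_mult)

lemma origin_prob_odd:
  assumes "odd n"
  shows "origin_prob n 0 = 0"
proof -
  have "coin_prob n 0 = 0"
  proof (rule ccontr)
    assume "coin_prob n 0 \<noteq> 0"
    then obtain k :: int where "0 = real n + 2 * of_int k" using coin_prob_neq_0D by blast
    then have "real_of_int (int n) = real_of_int (- 2 * k)" by simp
    then have "int n = - 2 * k" by (simp only: of_int_eq_iff)
    then have "even (int n)" by simp
    then show False using assms by simp
  qed
  then show ?thesis using origin_prob_eq_coin_prob[of n 0 0] by (simp add: zero_prod_def)
qed

text \<open>The absorption identity is applied twice, going from row 2j + 2 through 2j + 1 to 2j,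
  with the symmetry of the odd row in between.\<close>

lemma central_prob_Suc: "central_prob (Suc j) = central_prob j * (2 * real j + 1) / (2 * real j + 2)"
proof -
  have "Suc j * (Suc (Suc (2 * j)) choose Suc j) = Suc (Suc (2 * j)) * (Suc (2 * j) choose j)"
    by (rule Suc_times_binomial)
  then have 1: "real (Suc j) * real (Suc (Suc (2 * j)) choose Suc j)
      = real (Suc (Suc (2 * j))) * real (Suc (2 * j) choose j)"
    by (metis of_nat_mult)
  have "Suc j * (Suc (2 * j) choose Suc j) = Suc (2 * j) * (2 * j choose j)"
    by (rule Suc_times_binomial)
  moreover have "(Suc (2 * j) choose Suc j) = (Suc (2 * j) choose j)"
    using binomial_symmetric[of "Suc j" "Suc (2 * j)"] by simp
  ultimately have 2: "real (Suc j) * real (Suc (2 * j) choose j) = real (Suc (2 * j)) * real (2 * j choose j)"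
    by (metis of_nat_mult)
  have "real (Suc j) * real (Suc (Suc (2 * j)) choose Suc j) = real (Suc j) * (2 * real (Suc (2 * j) choose j))"
    using 1 by (simp add: algebra_simps del: binomial_Suc_Suc)
  then have "real (Suc (Suc (2 * j)) choose Suc j) = 2 * real (Suc (2 * j) choose j)"
    by (simp only: mult_cancel_left) simp
  then have "real (Suc j) * real (2 * Suc j choose Suc j) = 2 * (2 * real j + 1) * real (2 * j choose j)"
    using 2 by (simp add: algebra_simps del: binomial_Suc_Suc)
  then have "real (2 * Suc j choose Suc j) = 2 * (2 * real j + 1) * real (2 * j choose j) / real (Suc j)"
    by (simp add: field_simps del: binomial_Suc_Suc)
  then show ?thesis unfolding central_prob_def
    by (simp add: divide_simps del: binomial_Suc_Suc of_nat_Suc) (simp add: algebra_simps)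
qed

section \<open>Sharp bounds on central binomial probabilities from Wallis' product\<close>

lemma central_prob_pos: "central_prob j > 0"
  unfolding central_prob_def by simp

text \<open>The sequence is exactly the reciprocal of the partial Wallis product, which tends to pi
  / 2.\<close>

lemma central_prob_wallis: "(\<lambda>n. (2 * real n + 1) * (central_prob n)\<^sup>2) \<longlonglongrightarrow> 2 / pi"
proof -
  have eq: "(\<Prod>k=1..n. (4 * real k ^ 2) / (4 * real k ^ 2 - 1)) = inverse ((2 * real n + 1) * (central_prob n)\<^sup>2)" for n
  proof (induction n)
    case 0
    then show ?case by (simp add: central_prob_def)
  next
    case (Suc n)
    have alg: "inverse (a * c\<^sup>2) * (b\<^sup>2 / (a * d)) = inverse (d * (c * a / b)\<^sup>2)"
      if "a > 0" "b > 0" "c > 0" "d > 0" for a b c d :: real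
      using that by (simp add: divide_simps power2_eq_square)
    have 1: "4 * real (Suc n) ^ 2 = (2 * real n + 2)\<^sup>2"
      "4 * real (Suc n) ^ 2 - 1 = (2 * real n + 1) * (2 * real n + 3)"
      by (simp_all add: power2_eq_square algebra_simps)
    have "(\<Prod>k=1..Suc n. (4 * real k ^ 2) / (4 * real k ^ 2 - 1)) =
        inverse ((2 * real n + 1) * (central_prob n)\<^sup>2) *
          ((2 * real n + 2)\<^sup>2 / ((2 * real n + 1) * (2 * real n + 3)))"
      using Suc by (simp only: 1[symmetric]) simp
    also have "\<dots> = inverse ((2 * real (Suc n) + 1) * (central_prob (Suc n))\<^sup>2)"
      using alg[of "2 * real n + 1" "2 * real n + 2" "central_prob n" "2 * real n + 3"] central_prob_pos[of n]
      by (simp add: central_prob_Suc add.commute)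
    finally show ?case .
  qed
  show ?thesis
    using tendsto_inverse[OF wallis] unfolding eq by simp
qed

text \<open>The Wallis sequence decreases, so it stays above its limit 2 / pi.\<close>

lemma central_prob_lower: "1 / (pi * (real n + 1 / 2)) \<le> (central_prob n)\<^sup>2"
proof -
  have "decseq (\<lambda>n. (2 * real n + 1) * (central_prob n)\<^sup>2)"
  proof (rule decseq_SucI)
    fix n
    \<comment> \<open>After cancelling 2n + 1 this is (2n + 3)(2n + 1) \<le> (2n + 2)^2; it says
      that consecutive terms have ratio at most 1.\<close>
    have "(2 * real n + 3) * (2 * real n + 1) ^ 2 \<le> (2 * real n + 1) * (2 * real n + 2) ^ 2"
      by (simp add: power2_eq_square algebra_simps)
    then have "(2 * real n + 3) * ((2 * real n + 1) / (2 * real n + 2)) ^ 2 \<le> 2 * real n + 1"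
      by (simp add: power_divide pos_divide_le_eq)
    from mult_right_mono[OF this, of "(central_prob n)\<^sup>2", OF zero_le_power2]
    have "(2 * real n + 3) * ((2 * real n + 1) / (2 * real n + 2) * central_prob n) ^ 2
        \<le> (2 * real n + 1) * (central_prob n)\<^sup>2"
      by (simp only: power_mult_distrib mult.assoc)
    then show "(2 * real (Suc n) + 1) * (central_prob (Suc n))\<^sup>2 \<le> (2 * real n + 1) * (central_prob n)\<^sup>2"
      by (simp add: central_prob_Suc mult.commute add.commute)
  qed
  then have "2 / pi \<le> (2 * real n + 1) * (central_prob n)\<^sup>2"
    using central_prob_wallis by (rule decseq_ge)
  then have "2 / pi / (2 * real n + 1) \<le> (central_prob n)\<^sup>2"
    by (subst pos_divide_le_eq) (auto simp: mult.commute)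
  also have "2 / pi / (2 * real n + 1) = 1 / (pi * (real n + 1 / 2))"
    by (simp add: field_simps)
  finally show ?thesis .
qed

text \<open>With the factor n in place of 2n + 1 the sequence increases instead, so it stays below
  its limit 1 / pi.\<close>

lemma central_prob_upper:
  assumes "n \<ge> 1"
  shows "(central_prob n)\<^sup>2 \<le> 1 / (pi * real n)"
proof -
  define f where "f n = real (Suc n) * (central_prob (Suc n))\<^sup>2" for n
  have "incseq f"
  proof (rule incseq_SucI)
    fix n
    have "real (n + 1) * (2 * real n + 4) ^ 2 \<le> real (n + 2) * (2 * real n + 3) ^ 2"
      by (simp add: power2_eq_square algebra_simps)
    then have "real (n + 1) \<le> real (n + 2) * ((2 * real n + 3) / (2 * real n + 4)) ^ 2"
      by (simp add: power_divide pos_le_divide_eq)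
    from mult_right_mono[OF this, of "(central_prob (Suc n))\<^sup>2", OF zero_le_power2]
    have "real (n + 1) * (central_prob (Suc n))\<^sup>2
        \<le> real (n + 2) * ((2 * real n + 3) / (2 * real n + 4) * central_prob (Suc n)) ^ 2"
      by (simp only: power_mult_distrib mult.assoc)
    moreover have "(2 * real n + 3) / (2 * real n + 4) * central_prob (Suc n) = central_prob (Suc (Suc n))"
      by (simp only: central_prob_Suc[of "Suc n"]) (simp add: mult.commute add.commute)
    ultimately show "f n \<le> f (Suc n)"
      by (simp add: f_def)
  qed
  moreover have "f \<longlonglongrightarrow> 1 / pi"
  proof -
    \<comment> \<open>The limit is read off from Wallis: the correction factor n / (2n + 1) tends to
      1/2.\<close>
    have "(\<lambda>n. (real n / (2 * real n + 1)) * ((2 * real n + 1) * (central_prob n)\<^sup>2)) \<longlonglongrightarrow> 1 / 2 * (2 / pi)"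
      by (intro tendsto_mult central_prob_wallis) real_asymp
    moreover have "(real n / (2 * real n + 1)) * ((2 * real n + 1) * (central_prob n)\<^sup>2) = real n * (central_prob n)\<^sup>2" for n
      by simp
    ultimately have "(\<lambda>n. real n * (central_prob n)\<^sup>2) \<longlonglongrightarrow> 1 / pi" by simp
    from LIMSEQ_Suc[OF this] show ?thesis unfolding f_def .
  qed
  ultimately have "f (n - 1) \<le> 1 / pi" by (rule incseq_le)
  then show ?thesis using assms by (simp add: f_def field_simps)
qed

section \<open>Logarithmic growth of the Green function\<close>

lemma green_eq: "green n = (\<Sum>j=1..n div 2. (central_prob j)\<^sup>2)"
proof (induction n)
  case (Suc n)
  show ?case
  proof (cases "even n")
    case True
    then show ?thesis using Suc origin_prob_odd[of "Suc n"] by (simp add: green_def)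
  next
    case False
    then obtain m where m: "n = 2 * m + 1" by (elim oddE)
    then show ?thesis using Suc origin_prob_even[of "Suc m"] by (simp add: green_def)
  qed
qed (simp add: green_def)

lemma green_nonneg: "0 \<le> green n"
  unfolding green_def by (intro sum_nonneg origin_prob_nonneg)

text \<open>The terms are at most 1 / (pi j), and 1 / (m + 1) \<le> ln (m + 1) - ln m telescopes.
  The summand 1 pays for the first term.\<close>

lemma green_upper:
  assumes "n \<ge> 1"
  shows "green n \<le> (ln (real n) + 1) / pi"
proof -
  have "(\<Sum>j=1..m. (central_prob j)\<^sup>2) \<le> (ln (real m) + 1) / pi" if "m \<ge> 1" for m
    using that
  proof (induction m rule: dec_induct)
    case base
    then show ?case using central_prob_upper[of 1] by simp
  next
    case (step m)
    have "ln (real m / real (Suc m)) \<le> real m / real (Suc m) - 1"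
      using step by (intro ln_le_minus_one) simp
    also have "real m / real (Suc m) - 1 = - (1 / real (Suc m))"
      by (simp add: field_simps)
    finally have "1 / real (Suc m) \<le> ln (real (Suc m)) - ln (real m)"
      using step by (simp add: ln_div)
    moreover have "(central_prob (Suc m))\<^sup>2 \<le> 1 / real (Suc m) / pi"
      using central_prob_upper[of "Suc m"] by (simp add: mult.commute)
    ultimately have "(central_prob (Suc m))\<^sup>2 \<le> (ln (real (Suc m)) - ln (real m)) / pi"
      by (meson divide_right_mono order_trans pi_ge_zero)
    then show ?case using step by (simp add: add_divide_distrib diff_divide_distrib)
  qed
  note m = this
  show ?thesis
  proof (cases "n div 2 \<ge> 1")
    case True
    have "green n \<le> (ln (real (n div 2)) + 1) / pi"
      using m[OF True] green_eq by simp
    \<comment> \<open>Replacing n div 2 by n loses only a bounded amount in the logarithm.\<close>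
    also have "\<dots> \<le> (ln (real n) + 1) / pi"
      using True by (intro divide_right_mono add_right_mono ln_mono) auto
    finally show ?thesis .
  next
    case False
    then have "green n = 0" by (simp add: green_eq)
    then show ?thesis using assms by simp
  qed
qed

text \<open>The same telescoping from below. The offset 3/2 matches the bound 1 / (pi (j + 1/2)) at
  j = m + 1.\<close>

lemma green_lower:
  assumes "n \<ge> 1"
  shows "(ln (real n) - ln 3) / pi \<le> green n"
proof -
  have m: "(ln (real m + 3 / 2) - ln (3 / 2)) / pi \<le> (\<Sum>j=1..m. (central_prob j)\<^sup>2)" for m
  proof (induction m)
    case (Suc m)
    have "ln ((real m + 5 / 2) / (real m + 3 / 2)) \<le> (real m + 5 / 2) / (real m + 3 / 2) - 1"
      by (intro ln_le_minus_one) simp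
    also have "(real m + 5 / 2) / (real m + 3 / 2) - 1 = 1 / (real m + 3 / 2)"
      by (simp add: field_simps)
    finally have "ln (real m + 5 / 2) - ln (real m + 3 / 2) \<le> 1 / (real m + 3 / 2)"
      by (simp add: ln_div)
    then have "(ln (real m + 5 / 2) - ln (real m + 3 / 2)) / pi \<le> 1 / (real m + 3 / 2) / pi"
      by (intro divide_right_mono) auto
    also have "\<dots> = 1 / (pi * (real (Suc m) + 1 / 2))" by (simp add: algebra_simps)
    also have "\<dots> \<le> (central_prob (Suc m))\<^sup>2" by (rule central_prob_lower)
    finally show ?case using Suc by (simp add: diff_divide_distrib add_divide_distrib algebra_simps)
  qed simp
  \<comment> \<open>The constant ln 3 arises here: ln (n / 2) - ln (3 / 2) = ln n - ln 3.\<close>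
  have "real n / 2 \<le> real (n div 2) + 3 / 2" by linarith
  then have "ln (real n / 2) \<le> ln (real (n div 2) + 3 / 2)"
    using assms by (intro ln_mono) auto
  then have "ln (real n) - ln 3 \<le> ln (real (n div 2) + 3 / 2) - ln (3 / 2)"
    using assms by (simp add: ln_div)
  then show ?thesis
    unfolding green_eq by (intro order_trans[OF divide_right_mono m]) auto
qed

section \<open>Two-sided bounds from the renewal equation, and their limit\<close>

lemma zeros_gf_upper:
  assumes "0 \<le> p" "p \<le> 1"
  shows "zeros_gf (1 - p) n 0 \<le> 1 / (1 + p * green n)"
proof -
  define w where "w n = zeros_gf (1 - p) n 0" for n
  \<comment> \<open>As w decreases, every factor w (n - k) in the renewal equation is at least w
    n.\<close>
  have "w n * green n \<le> (\<Sum>k=1..n. origin_prob k 0 * w (n - k))"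
    unfolding green_def sum_distrib_left w_def
    using assms zeros_gf_antimono[of "1 - p" "n - k" n 0 for k]
    by (intro sum_mono) (auto simp: mult.commute intro!: mult_left_mono origin_prob_nonneg)
  then have "p * (w n * green n) \<le> p * (\<Sum>k=1..n. origin_prob k 0 * w (n - k))"
    using assms by (intro mult_left_mono)
  then have "w n * (1 + p * green n) \<le> 1"
    using renewal[of "1 - p" n 0] unfolding w_def by (simp add: algebra_simps)
  moreover have "1 + p * green n > 0"
    using assms green_nonneg[of n] by (simp add: add_pos_nonneg)
  ultimately show ?thesis by (simp add: w_def pos_le_divide_eq)
qed

text \<open>The renewal equation at time 2n, where the terms with k > n contribute at most a constant
  because the Green function grows logarithmically.\<close>
lemma zeros_gf_lower:
  assumes "0 \<le> p" "p \<le> 1" "n \<ge> 1"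
  shows "(1 - 3 * p) / (1 + p * green n) \<le> zeros_gf (1 - p) n 0"
proof -
  define w where "w n = zeros_gf (1 - p) n 0" for n
  have w: "0 \<le> w k" "w k \<le> 1" for k
    using zeros_gf_bounds[of "1 - p" k 0] assms by (auto simp: w_def)
  have mono: "w k \<le> w n" if "n \<le> k" for k
    using zeros_gf_antimono[of "1 - p" n k 0] that assms by (simp add: w_def)
  have split: "(\<Sum>k=1..2 * n. f k) = (\<Sum>k=1..n. f k) + (\<Sum>k=n+1..2 * n. f k)" for f :: "nat \<Rightarrow> real"
    using sum.ub_add_nat[of 1 n f n] by (simp add: mult_2)
  \<comment> \<open>For k \<le> n one has 2n - k \<ge> n, so w (2n - k) \<le> w n; for k > n the
    trivial bound 1 is used.\<close>
  have "(\<Sum>k=1..2 * n. origin_prob k 0 * w (2 * n - k)) \<le>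
      (\<Sum>k=1..n. origin_prob k 0 * w n) + (\<Sum>k=n+1..2 * n. origin_prob k 0)"
    unfolding split
    by (intro add_mono sum_mono mult_left_mono mono mult_right_le_one_le origin_prob_nonneg w) auto
  also have "\<dots> = green n * w n + (green (2 * n) - green n)"
    unfolding green_def split by (simp add: sum_distrib_right)
  also have "green (2 * n) - green n \<le> (ln (real (2 * n)) + 1) / pi - (ln (real n) - ln 3) / pi"
    using green_upper[of "2 * n"] green_lower[of n] assms by (intro diff_mono) auto
  also have "\<dots> = (ln 6 + 1) / pi"
    using assms ln_mult[of 2 "3::real"] by (simp add: ln_mult diff_divide_distrib add_divide_distrib)
  \<comment> \<open>Source of the 3 in the statement: crudely, ln 6 + 1 \<le> 6 \<le> 3 pi.\<close>
  also have "\<dots> \<le> 3"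
  proof -
    have "ln (6::real) \<le> 6 - 1" by (intro ln_le_minus_one) simp
    then have "ln (6::real) + 1 \<le> 3 * pi" using pi_gt3 by linarith
    then show ?thesis by (simp add: field_simps)
  qed
  finally have "(\<Sum>k=1..2 * n. origin_prob k 0 * w (2 * n - k)) \<le> green n * w n + 3"
    by simp
  then have "p * (\<Sum>k=1..2 * n. origin_prob k 0 * w (2 * n - k)) \<le> p * (green n * w n + 3)"
    using assms by (intro mult_left_mono)
  moreover have "w (2 * n) + p * (\<Sum>k=1..2 * n. origin_prob k 0 * w (2 * n - k)) = 1"
    using renewal[of "1 - p" "2 * n" 0] unfolding w_def by simp
  moreover have "w (2 * n) \<le> w n" by (rule mono) simp
  ultimately have "1 - 3 * p \<le> w n * (1 + p * green n)"
    by (simp add: algebra_simps)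
  moreover have "1 + p * green n > 0"
    using assms green_nonneg[of n] by (simp add: add_pos_nonneg)
  ultimately show ?thesis by (simp add: w_def pos_divide_le_eq)
qed

text \<open>At this time ln n is within 1 of t / p, so p times the Green function tends to t / pi
  and the two bounds on w meet.\<close>

lemma zeros_gf_limit:
  fixes p :: "real \<Rightarrow> real"
  assumes p: "(p \<longlongrightarrow> 0) F" "eventually (\<lambda>x. 0 < p x) F" and t: "t \<ge> 0"
  shows "((\<lambda>x. zeros_gf (1 - p x) (nat \<lfloor>exp (t / p x)\<rfloor>) 0) \<longlongrightarrow> 1 / (1 + t / pi)) F"
proof -
  define N where "N x = nat \<lfloor>exp (t / p x)\<rfloor>" for x
  have N: "N x \<ge> 1 \<and> ln (real (N x)) \<le> t / p x \<and> t / p x - 1 \<le> ln (real (N x))" if "0 < p x" for x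
  proof -
    have 1: "1 \<le> exp (t / p x)" using that t by simp
    then have N1: "N x \<ge> 1" unfolding N_def by (simp add: le_nat_floor)
    have le: "real (N x) \<le> exp (t / p x)" unfolding N_def using 1 by (simp add: of_nat_nat)
    \<comment> \<open>A real at least 1 is at most twice its floor; since 2 \<le> e, rounding down
      costs at most 1 in the logarithm.\<close>
    have "exp (t / p x) \<le> 2 * real (N x)"
      using N1 unfolding N_def by linarith
    also have "\<dots> \<le> exp 1 * real (N x)"
      using exp_ge_add_one_self[of 1] by (intro mult_right_mono) auto
    finally have "ln (exp (t / p x)) \<le> ln (exp 1 * real (N x))"
      using N1 by (subst ln_le_cancel_iff) auto
    then have "t / p x \<le> 1 + ln (real (N x))" using N1 by (simp add: ln_mult)
    moreover have "ln (real (N x)) \<le> ln (exp (t / p x))"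
      using N1 le by (subst ln_le_cancel_iff) auto
    ultimately show ?thesis using N1 by simp
  qed
  have pg: "((\<lambda>x. p x * green (N x)) \<longlongrightarrow> t / pi) F"
  proof (rule tendsto_sandwich)
    \<comment> \<open>The losses 1 from rounding and ln 3 from \<open>green_lower\<close> are
      multiplied by p and vanish in the limit.\<close>
    show "eventually (\<lambda>x. (t - p x * (1 + ln 3)) / pi \<le> p x * green (N x)) F"
      using p(2)
    proof eventually_elim
      case (elim x)
      have "(t - p x * (1 + ln 3)) / pi = p x * ((t / p x - 1 - ln 3) / pi)"
        using elim by (simp add: field_simps)
      also have "\<dots> \<le> p x * green (N x)"
        using N[OF elim] elim green_lower[of "N x"]
        by (intro mult_left_mono order_trans[OF divide_right_mono green_lower]) auto
      finally show ?case .
    qed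
    show "eventually (\<lambda>x. p x * green (N x) \<le> (t + p x) / pi) F"
      using p(2)
    proof eventually_elim
      case (elim x)
      have "p x * green (N x) \<le> p x * ((t / p x + 1) / pi)"
        using N[OF elim] elim
        by (intro mult_left_mono order_trans[OF green_upper divide_right_mono]) auto
      also have "\<dots> = (t + p x) / pi"
        using elim by (simp add: field_simps)
      finally show ?case .
    qed
    show "((\<lambda>x. (t - p x * (1 + ln 3)) / pi) \<longlongrightarrow> t / pi) F"
      by (rule tendsto_eq_intros p refl | simp)+
    show "((\<lambda>x. (t + p x) / pi) \<longlongrightarrow> t / pi) F"
      by (rule tendsto_eq_intros p refl | simp)+
  qed
  have nz: "1 + t / pi \<noteq> 0"
    using t by (simp add: add_nonneg_eq_0_iff)
  have ev: "eventually (\<lambda>x. 0 < p x \<and> p x < 1) F"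
    using p(2) order_tendstoD(2)[OF p(1), of 1] by (auto elim: eventually_elim2)
  show ?thesis
    unfolding N_def[symmetric]
  proof (rule tendsto_sandwich)
    show "eventually (\<lambda>x. (1 - 3 * p x) / (1 + p x * green (N x)) \<le> zeros_gf (1 - p x) (N x) 0) F"
      using ev by eventually_elim (use N in \<open>auto intro!: zeros_gf_lower\<close>)
    show "eventually (\<lambda>x. zeros_gf (1 - p x) (N x) 0 \<le> 1 / (1 + p x * green (N x))) F"
      using ev by eventually_elim (auto intro!: zeros_gf_upper)
    show "((\<lambda>x. (1 - 3 * p x) / (1 + p x * green (N x))) \<longlongrightarrow> 1 / (1 + t / pi)) F"
      by (rule tendsto_eq_intros p pg refl nz | simp)+
    show "((\<lambda>x. 1 / (1 + p x * green (N x))) \<longlongrightarrow> 1 / (1 + t / pi)) F"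
      by (rule tendsto_eq_intros p pg refl nz | simp)+
  qed
qed

subsection \<open>Independence\<close>

lemma sets_PiM_Collect_finite:
  assumes "finite K" "K \<subseteq> I" "\<And>i. i \<in> K \<Longrightarrow> B i \<in> sets N"
  shows "{r \<in> space (Pi\<^sub>M I (\<lambda>_. N)). \<forall>i\<in>K. r i \<in> B i} \<in> sets (Pi\<^sub>M I (\<lambda>_. N))"
proof (rule sets.sets_Collect_finite_All[OF _ assms(1)])
  fix i assume "i \<in> K"
  then have "(\<lambda>r. r i) -` B i \<inter> space (Pi\<^sub>M I (\<lambda>_. N)) \<in> sets (Pi\<^sub>M I (\<lambda>_. N))"
    using assms by (intro measurable_sets[OF measurable_component_singleton]) auto
  then show "{r \<in> space (Pi\<^sub>M I (\<lambda>_. N)). r i \<in> B i} \<in> sets (Pi\<^sub>M I (\<lambda>_. N))"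
    by (simp add: vimage_def Int_def conj_commute)
qed

lemma (in prob_space) indep_vars_prob_preimage:
  assumes X: "indep_vars (\<lambda>_. N) X I"
    and K: "finite K" "K \<subseteq> I" and B: "\<And>i. i \<in> K \<Longrightarrow> B i \<in> sets N"
  shows "prob ((\<lambda>\<omega>. \<lambda>i\<in>I. X i \<omega>) -` {r \<in> space (Pi\<^sub>M I (\<lambda>_. N)). \<forall>i\<in>K. r i \<in> B i} \<inter> space M)
    = (\<Prod>i\<in>K. prob (X i -` B i \<inter> space M))"
    (is "prob ?E = _")
proof -
  have rv: "\<And>i. i \<in> I \<Longrightarrow> random_variable N (X i)"
    using X by (simp add: indep_vars_def2)
  have sp: "X i \<omega> \<in> space N" if "i \<in> I" "\<omega> \<in> space M" for i \<omega>
    using measurable_space[OF rv] that by blast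
  show ?thesis
  proof (cases "K = {}")
    \<comment> \<open>\<open>indep_varsD\<close> wants a nonempty index set. Empty K does occur
      later, when an event involves only one of the two sequences; both sides are then 1.\<close>
    case True
    then have "?E = space M"
      using sp by (auto simp: space_PiM)
    then show ?thesis using True by (simp add: prob_space)
  next
    case False
    then have "?E = (\<Inter>i\<in>K. X i -` B i \<inter> space M)"
      using K sp by (auto simp: space_PiM)
    also have "prob \<dots> = (\<Prod>i\<in>K. prob (X i -` B i \<inter> space M))"
      using False K B by (intro indep_varsD[OF X]) auto
    finally show ?thesis .
  qed
qed

text \<open>Merges the two sequences into one independent family, so that disjoint blocks mixing X
  and Y become independent. A finite intersection splits into an X-cylinder and a Y-cylinder:
  independence of the sequences separates these, independence within each sequence factors
  them.\<close>

lemma (in prob_space) indep_seqs_imp_indep_vars_Plus: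
  assumes X: "indep_vars (\<lambda>_. N) X I" and Y: "indep_vars (\<lambda>_. N) Y J"
    and XY: "indep_seqs N X I N Y J"
  shows "indep_vars (\<lambda>_. N) (case_sum X Y) (I <+> J)"
  unfolding indep_vars_def2
proof (intro conjI ballI indep_setsI)
  have rvX [measurable]: "\<And>i. i \<in> I \<Longrightarrow> random_variable N (X i)" using X by (simp add: indep_vars_def2)
  have rvY [measurable]: "\<And>i. i \<in> J \<Longrightarrow> random_variable N (Y i)" using Y by (simp add: indep_vars_def2)
  have spX: "X i \<omega> \<in> space N" if "i \<in> I" "\<omega> \<in> space M" for i \<omega>
    using measurable_space[OF rvX] that by blast
  have spY: "Y i \<omega> \<in> space N" if "i \<in> J" "\<omega> \<in> space M" for i \<omega>
    using measurable_space[OF rvY] that by blast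
  show rv: "random_variable N (case_sum X Y k)" if "k \<in> I <+> J" for k
    using that rvX rvY by auto
  show "{case_sum X Y k -` A \<inter> space M |A. A \<in> sets N} \<subseteq> events" if "k \<in> I <+> J" for k
    using rv[OF that] by (auto intro: measurable_sets)
  fix A K assume K: "K \<noteq> {}" "K \<subseteq> I <+> J" "finite K"
    and "\<forall>k\<in>K. A k \<in> {case_sum X Y k -` A \<inter> space M |A. A \<in> sets N}"
  then have "\<forall>k\<in>K. \<exists>B. B \<in> sets N \<and> A k = case_sum X Y k -` B \<inter> space M" by blast
  then obtain B where B: "\<And>k. k \<in> K \<Longrightarrow> B k \<in> sets N" "\<And>k. k \<in> K \<Longrightarrow> A k = case_sum X Y k -` B k \<inter> space M"
    by metis
  define K1 K2 where "K1 = Inl -` K" and "K2 = Inr -` K"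
  have K12: "K1 \<subseteq> I" "K2 \<subseteq> J" "finite K1" "finite K2"
    using K by (auto simp: K1_def K2_def intro: finite_vimageI)
  have B1: "\<And>i. i \<in> K1 \<Longrightarrow> B (Inl i) \<in> sets N" and B2: "\<And>i. i \<in> K2 \<Longrightarrow> B (Inr i) \<in> sets N"
    using B by (auto simp: K1_def K2_def)
  have KU: "K = Inl ` K1 \<union> Inr ` K2"
    unfolding K1_def K2_def by (auto simp: image_iff) (metis old.sum.exhaust)
  define SX where "SX = {r \<in> space (Pi\<^sub>M I (\<lambda>_. N)). \<forall>i\<in>K1. r i \<in> B (Inl i)}"
  define SY where "SY = {r \<in> space (Pi\<^sub>M J (\<lambda>_. N)). \<forall>i\<in>K2. r i \<in> B (Inr i)}"
  have [measurable]: "SX \<in> sets (Pi\<^sub>M I (\<lambda>_. N))" "SY \<in> sets (Pi\<^sub>M J (\<lambda>_. N))"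
    unfolding SX_def SY_def using K12 B1 B2 by (auto intro!: sets_PiM_Collect_finite)
  have "(\<Prod>i\<in>K1. prob (A (Inl i))) = (\<Prod>i\<in>K1. prob (X i -` B (Inl i) \<inter> space M))"
    using B(2) by (intro prod.cong) (auto simp: K1_def)
  then have prodX: "prob ((\<lambda>\<omega>. \<lambda>i\<in>I. X i \<omega>) -` SX \<inter> space M) = (\<Prod>i\<in>K1. prob (A (Inl i)))"
    unfolding SX_def using K12 B1 by (simp only: indep_vars_prob_preimage[OF X])
  have "(\<Prod>i\<in>K2. prob (A (Inr i))) = (\<Prod>i\<in>K2. prob (Y i -` B (Inr i) \<inter> space M))"
    using B(2) by (intro prod.cong) (auto simp: K2_def)
  then have prodY: "prob ((\<lambda>\<omega>. \<lambda>i\<in>J. Y i \<omega>) -` SY \<inter> space M) = (\<Prod>i\<in>K2. prob (A (Inr i)))"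
    unfolding SY_def using K12 B2 by (simp only: indep_vars_prob_preimage[OF Y])
  have "\<Inter>(A ` K) = (\<lambda>\<omega>. (\<lambda>i\<in>I. X i \<omega>, \<lambda>j\<in>J. Y j \<omega>)) -` (SX \<times> SY) \<inter> space M"
  proof -
    have eq: "\<omega> \<in> \<Inter>(A ` K) \<longleftrightarrow>
        \<omega> \<in> space M \<and> (\<forall>i\<in>K1. X i \<omega> \<in> B (Inl i)) \<and> (\<forall>i\<in>K2. Y i \<omega> \<in> B (Inr i))" for \<omega>
    proof -
      have "\<omega> \<in> \<Inter>(A ` K) \<longleftrightarrow> \<omega> \<in> space M \<and> (\<forall>k\<in>K. case_sum X Y k \<omega> \<in> B k)"
        using K(1) B(2) by auto
      then show ?thesis unfolding KU by (simp add: ball_Un)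
    qed
    show ?thesis
      unfolding set_eq_iff eq using K12 spX spY
      by (auto simp: SX_def SY_def space_PiM subset_eq)
  qed
  also have "prob \<dots> = prob ((\<lambda>\<omega>. \<lambda>i\<in>I. X i \<omega>) -` SX \<inter> space M) * prob ((\<lambda>\<omega>. \<lambda>i\<in>J. Y i \<omega>) -` SY \<inter> space M)"
    using XY unfolding indep_seqs_def by (rule indep_varD) auto
  also have "\<dots> = (\<Prod>k\<in>K. prob (A k))"
    unfolding prodX prodY KU
    by (subst prod.union_disjoint) (use K12 in \<open>auto simp: prod.reindex\<close>)
  finally show "prob (\<Inter>(A ` K)) = (\<Prod>k\<in>K. prob (A k))" .
qed

text \<open>Fubini for the product law of U and V: the second variable is averaged out with the
  first one frozen. The map g extracts from a block V the part that h uses.\<close>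

lemma (in prob_space) expectation_indep_var:
  fixes h :: "'b \<times> 'c \<Rightarrow> real"
  assumes ind: "indep_var S U T V" and g [measurable]: "g \<in> measurable T R"
    and h [measurable]: "h \<in> borel_measurable (S \<Otimes>\<^sub>M R)" and bound: "\<And>z. \<bar>h z\<bar> \<le> C"
  shows "expectation (\<lambda>\<omega>. h (U \<omega>, g (V \<omega>))) =
    expectation (\<lambda>\<omega>. \<integral>v. h (U \<omega>, v) \<partial>distr M R (\<lambda>\<omega>. g (V \<omega>)))"
proof -
  have [measurable]: "random_variable S U" "random_variable T V"
    and eq: "distr M S U \<Otimes>\<^sub>M distr M T V = distr M (S \<Otimes>\<^sub>M T) (\<lambda>x. (U x, V x))"
    using ind by (auto simp: indep_var_distribution_eq)
  interpret U: prob_space "distr M S U" by (rule prob_space_distr) simp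
  interpret V: prob_space "distr M T V" by (rule prob_space_distr) simp
  interpret UV: pair_prob_space "distr M S U" "distr M T V" ..
  have "expectation (\<lambda>\<omega>. h (U \<omega>, g (V \<omega>))) =
      (\<integral>z. h (fst z, g (snd z)) \<partial>distr M (S \<Otimes>\<^sub>M T) (\<lambda>x. (U x, V x)))"
    by (subst integral_distr) auto
  also have "\<dots> = (\<integral>z. h (fst z, g (snd z)) \<partial>(distr M S U \<Otimes>\<^sub>M distr M T V))" by (simp only: eq)
  also have "\<dots> = (\<integral>u. \<integral>v. h (u, g v) \<partial>distr M T V \<partial>distr M S U)"
    by (subst UV.integral_fst'[symmetric])
      (auto intro!: UV.P.integrable_const_bound[where B = C] simp: bound)
  also have "\<dots> = expectation (\<lambda>\<omega>. \<integral>v. h (U \<omega>, g v) \<partial>distr M T V)"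
    by (subst integral_distr) auto
  also have "\<dots> = expectation (\<lambda>\<omega>. \<integral>v. h (U \<omega>, v) \<partial>distr M R (\<lambda>\<omega>. g (V \<omega>)))"
  proof (intro Bochner_Integration.integral_cong refl)
    fix \<omega> assume "\<omega> \<in> space M"
    then have [measurable]: "U \<omega> \<in> space S" by (metis \<open>random_variable S U\<close> measurable_space)
    show "(\<integral>v. h (U \<omega>, g v) \<partial>distr M T V) = (\<integral>v. h (U \<omega>, v) \<partial>distr M R (\<lambda>\<omega>. g (V \<omega>)))"
      by (simp add: integral_distr)
  qed
  finally show ?thesis .
qed

subsection \<open>The perturbed walk\<close>

definition lattice :: "(real \<times> real) set" where
  "lattice = \<int> \<times> \<int>"

lemma unit_steps_subset_lattice: "unit_steps \<subseteq> lattice"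
  by (auto simp: unit_steps_def lattice_def)

lemma lattice_add: "x \<in> lattice \<Longrightarrow> y \<in> lattice \<Longrightarrow> x + y \<in> lattice"
  by (auto simp: lattice_def plus_prod_def)

lemma measure_square:
  assumes "a \<le> b"
  shows "measure lborel ({a<..<b} \<times> {a<..<b}) = (b - a :: real)\<^sup>2"
proof -
  have "{a<..<b} \<times> {a<..<b} = box (a, a) (b, b)"
    by (auto simp: box_def Basis_prod_def Basis_real_def)
  then show ?thesis
    using assms by (simp add: measure_lborel_box_eq Basis_prod_def Basis_real_def power2_eq_square)
qed

lemma measure_ball_plane:
  assumes "\<epsilon> \<ge> 0"
  shows "measure lborel (ball (x :: real \<times> real) \<epsilon>) = pi * \<epsilon>\<^sup>2"
  using content_ball[OF assms, of x] by (simp add: unit_ball_vol_2 power2_eq_square)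

text \<open>For y0 farther than \<epsilon> from the boundary, the ball around y0 lies inside the
  square, while its translates by nonzero lattice vectors miss the square. This is why boundary
  starts are excluded.\<close>

lemma measure_uniform_near:
  fixes z y0 :: "real \<times> real"
  assumes "0 < \<epsilon>" "y0 \<in> {\<epsilon><..<1 - \<epsilon>} \<times> {\<epsilon><..<1 - \<epsilon>}" "z \<in> lattice"
  shows "measure (uniform_measure lborel ({0<..<1} \<times> {0<..<1})) {y. norm (z + y - y0) < \<epsilon>}
    = (if z = 0 then pi * \<epsilon>\<^sup>2 else 0)"
proof -
  define Q :: "(real \<times> real) set" where "Q = {0<..<1} \<times> {0<..<1}"
  have coords: "\<bar>fst v\<bar> < \<epsilon> \<and> \<bar>snd v\<bar> < \<epsilon>" if "norm v < \<epsilon>" for v :: "real \<times> real"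
    using that norm_fst_le[of "fst v" "snd v"] norm_snd_le[of "snd v" "fst v"] by auto
  have [measurable]: "Q \<in> sets borel" unfolding Q_def by (intro borel_open open_Times) auto
  have Q1: "measure lborel Q = 1" unfolding Q_def using measure_square[of 0 1] by simp
  then have "emeasure lborel Q = 1"
    by (metis emeasure_eq_ennreal_measure ennreal_1 measure_zero_top zero_neq_one)
  then have "measure (uniform_measure lborel Q) {y. norm (z + y - y0) < \<epsilon>}
      = measure lborel (Q \<inter> {y. norm (z + y - y0) < \<epsilon>})"
    using Q1 by (subst measure_uniform_measure) auto
  also have "\<dots> = (if z = 0 then pi * \<epsilon>\<^sup>2 else 0)"
  proof (cases "z = 0")
    case True
    have "Q \<inter> {y. norm (z + y - y0) < \<epsilon>} = ball y0 \<epsilon>"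
    proof -
      have "y \<in> Q" if "norm (y - y0) < \<epsilon>" for y
        using coords[OF that] assms unfolding Q_def by (auto simp: mem_Times_iff)
      then show ?thesis using True by (auto simp: dist_norm norm_minus_commute)
    qed
    then show ?thesis using True assms by (simp add: measure_ball_plane)
  next
    case False
    \<comment> \<open>Some coordinate of z has modulus at least 1, whereas the coordinates of y - y0
      have modulus below 1 - \<epsilon>; their sum exceeds \<epsilon> in modulus.\<close>
    then have "1 \<le> \<bar>fst z\<bar> \<or> 1 \<le> \<bar>snd z\<bar>"
      using assms Ints_nonzero_abs_ge1 unfolding lattice_def by (auto simp: mem_Times_iff prod_eq_iff)
    then have "\<not> norm (z + y - y0) < \<epsilon>" if "y \<in> Q" for y
      using coords[of "z + y - y0"] that assms unfolding Q_def by (auto simp: mem_Times_iff)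
    then have "Q \<inter> {y. norm (z + y - y0) < \<epsilon>} = {}" by blast
    then show ?thesis using False by simp
  qed
  finally show ?thesis unfolding Q_def .
qed

lemma borel_measurable_zeros_gf [measurable]: "zeros_gf q n \<in> borel_measurable borel"
proof (induction n)
  case (Suc n)
  have [measurable]: "(\<lambda>x :: real \<times> real. if x + e = 0 then q else 1) \<in> borel_measurable borel" for e
    by measurable
  note Suc [measurable]
  show ?case unfolding zeros_gf.simps by measurable
qed simp

locale perturbed_srw = prob_space M for M :: "'a measure" +
  fixes X Y :: "nat \<Rightarrow> 'a \<Rightarrow> real \<times> real"
  assumes iid_X: "iid_vars borel X {1..}"
    and iid_Y: "iid_vars borel Y UNIV"
    and indep_XY: "indep_seqs borel X {1..} borel Y UNIV"
    and distr_X1: "distr M borel (X 1) = distr (measure_pmf (pmf_of_set unit_steps)) borel (\<lambda>x. x)"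
    and distr_Y0: "distr M borel (Y 0) = uniform_measure lborel ({0<..<1} \<times> {0<..<1})"
begin

lemma measurable_X [measurable]: "1 \<le> k \<Longrightarrow> random_variable borel (X k)"
  using iid_X by (simp add: iid_vars_def indep_vars_def2)

lemma measurable_Y [measurable]: "random_variable borel (Y k)"
  using iid_Y by (simp add: iid_vars_def indep_vars_def2)

lemma indep_vars_XY: "indep_vars (\<lambda>_. borel) (case_sum X Y) ({1..} <+> UNIV)"
  using iid_X iid_Y indep_XY
  by (intro indep_seqs_imp_indep_vars_Plus) (auto simp: iid_vars_def)

lemma measurable_walk [measurable]: "random_variable borel (walk X k)"
  unfolding walk_def[abs_def] by (intro borel_measurable_sum) auto

lemma measurable_perturbed_walk [measurable]: "random_variable borel (perturbed_walk X Y k)"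
  unfolding perturbed_walk_def[abs_def] by measurable

lemma distr_X:
  assumes "1 \<le> k"
  shows "distr M borel (X k) = distr (measure_pmf (pmf_of_set unit_steps)) borel (\<lambda>x. x)"
proof -
  have "\<forall>i\<in>{1..}. \<forall>j\<in>{1..}. distr M borel (X i) = distr M borel (X j)"
    using iid_X unfolding iid_vars_def by (rule conjunct2)
  then have "distr M borel (X k) = distr M borel (X 1)"
    using assms by (meson atLeast_iff order_refl)
  then show ?thesis by (simp only: distr_X1)
qed

lemma distr_Y: "distr M borel (Y k) = uniform_measure lborel ({0<..<1} \<times> {0<..<1})"
  using iid_Y unfolding iid_vars_def distr_Y0[symmetric] by auto

text \<open>The steps are prescribed only in law, so the walk lies on the lattice only almost
  surely.\<close>

lemma AE_walk_lattice: "AE \<omega> in M. walk X k \<omega> \<in> lattice"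
proof -
  have step: "AE \<omega> in M. X i \<omega> \<in> unit_steps" if "1 \<le> i" for i
  proof -
    have fin: "finite unit_steps" "unit_steps \<noteq> {}" by (auto simp: unit_steps_def)
    have [measurable]: "unit_steps \<in> sets borel"
      using fin by (intro borel_closed finite_imp_closed)
    have "AE x in distr M borel (X i). x \<in> unit_steps"
      unfolding distr_X[OF that] using fin by (subst AE_distr_iff) (auto simp: AE_measure_pmf_iff)
    then show ?thesis using that by (subst (asm) AE_distr_iff) auto
  qed
  then have "AE \<omega> in M. \<forall>i\<in>{1..k}. X i \<omega> \<in> unit_steps"
    by (intro AE_finite_allI) auto
  then show ?thesis
  proof eventually_elim
    case (elim \<omega>)
    have "(\<Sum>i=1..j. X i \<omega>) \<in> lattice" if "j \<le> k" for j
      using that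
    proof (induction j)
      case (Suc j)
      then show ?case using elim unit_steps_subset_lattice by (auto intro!: lattice_add)
    qed (simp add: lattice_def zero_prod_def)
    then show ?case by (simp add: walk_def)
  qed
qed

text \<open>The event that the return time exceeds n, as a finite conjunction and hence visibly
  measurable.\<close>

definition avoids :: "real \<Rightarrow> nat \<Rightarrow> 'a \<Rightarrow> bool" where
  "avoids \<epsilon> n \<omega> \<longleftrightarrow>
     (\<forall>m\<in>{1..n}. \<not> norm (perturbed_walk X Y m \<omega> - perturbed_walk X Y 0 \<omega>) < \<epsilon>)"

definition interior_start :: "real \<Rightarrow> 'a \<Rightarrow> bool" where
  "interior_start \<epsilon> \<omega> \<longleftrightarrow> Y 0 \<omega> \<in> {\<epsilon><..<1 - \<epsilon>} \<times> {\<epsilon><..<1 - \<epsilon>}"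

lemma measurable_avoids [measurable]: "Measurable.pred M (avoids \<epsilon> n)"
  unfolding avoids_def[abs_def] by measurable

lemma borel_square [measurable]: "({a<..<b::real} \<times> {c<..<d::real}) \<in> sets borel"
  by (intro borel_open open_Times) auto

lemma measurable_interior_start [measurable]: "Measurable.pred M (interior_start \<epsilon>)"
  unfolding interior_start_def[abs_def] by measurable

lemma avoids_Suc: "avoids \<epsilon> (Suc n) \<omega> \<longleftrightarrow> avoids \<epsilon> n \<omega> \<and>
    \<not> norm (walk X n \<omega> + X (Suc n) \<omega> + Y (Suc n) \<omega> - Y 0 \<omega>) < \<epsilon>"
  by (auto simp: avoids_def atLeastAtMostSuc_conv perturbed_walk_def walk_def add_ac)

text \<open>One fresh pair (X i, Y i) is integrated out, with the past frozen to the position s and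
  the start y0. For f = \<open>zeros_gf q j\<close> the right-hand side is the recursion defining
  \<open>zeros_gf q (Suc j)\<close>.\<close>

lemma integral_step:
  assumes "0 < \<epsilon>" "y0 \<in> {\<epsilon><..<1 - \<epsilon>} \<times> {\<epsilon><..<1 - \<epsilon>}" "s \<in> lattice" "1 \<le> i"
  assumes f [measurable]: "f \<in> borel_measurable borel" and bound: "\<And>x. \<bar>f x\<bar> \<le> 1"
  shows "(\<integral>v. of_bool (\<not> norm (s + fst v + snd v - y0) < \<epsilon>) * f (s + fst v)
      \<partial>distr M (borel \<Otimes>\<^sub>M borel) (\<lambda>\<omega>. (X i \<omega>, Y i \<omega>))) =
    (\<Sum>e\<in>unit_steps. (if s + e = 0 then 1 - pi * \<epsilon>\<^sup>2 else 1) * f (s + e)) / 4"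
proof -
  define DX where "DX = distr M borel (X i)"
  define DY where "DY = distr M borel (Y i)"
  \<comment> \<open>X i and Y i are the singleton blocks Inl i and Inr i of the merged
    family.\<close>
  have "indep_var borel ((\<lambda>r. r (Inl i)) \<circ> (\<lambda>\<omega>. restrict (\<lambda>k. case_sum X Y k \<omega>) {Inl i}))
      borel ((\<lambda>r. r (Inr i)) \<circ> (\<lambda>\<omega>. restrict (\<lambda>k. case_sum X Y k \<omega>) {Inr i}))"
    using assms by (intro indep_var_compose[OF indep_var_restrict[OF indep_vars_XY]]) auto
  then have "indep_var borel (X i) borel (Y i)" by (simp add: o_def)
  then have D: "distr M (borel \<Otimes>\<^sub>M borel) (\<lambda>\<omega>. (X i \<omega>, Y i \<omega>)) = DX \<Otimes>\<^sub>M DY"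
    unfolding DX_def DY_def by (simp add: indep_var_distribution_eq)
  interpret DX: prob_space DX unfolding DX_def using assms by (intro prob_space_distr) auto
  interpret DY: prob_space DY unfolding DY_def by (intro prob_space_distr) auto
  interpret DXY: pair_prob_space DX DY ..
  have [measurable_cong]: "sets DX = sets borel" "sets DY = sets borel"
    by (simp_all add: DX_def DY_def)
  define h where "h v = of_bool (\<not> norm (s + fst v + snd v - y0) < \<epsilon>) * f (s + fst v)"
    for v :: "(real \<times> real) \<times> real \<times> real"
  have [measurable]: "h \<in> borel_measurable (borel \<Otimes>\<^sub>M borel)"
    unfolding h_def of_bool_def by measurable
  have hb: "\<bar>h v\<bar> \<le> 1" for v unfolding h_def using bound[of "s + fst v"] by simp
  \<comment> \<open>With the step e fixed, f (s + e) factors out, and what remains is the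
    probability that Y i misses the ball.\<close>
  have inner: "(\<integral>y. h (e, y) \<partial>DY) = (if s + e = 0 then 1 - pi * \<epsilon>\<^sup>2 else 1) * f (s + e)"
    if "e \<in> unit_steps" for e
  proof -
    have "(\<integral>y. h (e, y) \<partial>DY) = (\<integral>y. indicator {y. \<not> norm (s + e + y - y0) < \<epsilon>} y \<partial>DY) * f (s + e)"
      unfolding h_def by (subst Bochner_Integration.integral_mult_left_zero[symmetric])
        (intro Bochner_Integration.integral_cong, auto simp: indicator_def)
    also have "(\<integral>y. indicator {y. \<not> norm (s + e + y - y0) < \<epsilon>} y \<partial>DY) =
        measure DY {y. \<not> norm (s + e + y - y0) < \<epsilon>}"
      by (simp add: DY_def)
    also have "\<dots> = 1 - measure DY {y. norm (s + e + y - y0) < \<epsilon>}"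
      using DY.prob_compl[of "{y. norm (s + e + y - y0) < \<epsilon>}"]
      by (simp add: DY_def Compl_eq_Diff_UNIV[symmetric] Collect_neg_eq)
    also have "measure DY {y. norm (s + e + y - y0) < \<epsilon>} = (if s + e = 0 then pi * \<epsilon>\<^sup>2 else 0)"
      unfolding DY_def distr_Y using assms that unit_steps_subset_lattice
      by (intro measure_uniform_near lattice_add) auto
    finally show ?thesis by simp
  qed
  have "(\<integral>v. h v \<partial>(DX \<Otimes>\<^sub>M DY)) = (\<integral>x. \<integral>y. h (x, y) \<partial>DY \<partial>DX)"
    by (subst DXY.integral_fst'[symmetric])
      (auto intro!: DXY.P.integrable_const_bound[where B = 1] simp: hb)
  also have "\<dots> = (\<integral>x. \<integral>y. h (x, y) \<partial>DY \<partial>measure_pmf (pmf_of_set unit_steps))"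
    unfolding DX_def distr_X[OF assms(4)] by (subst integral_distr) auto
  also have "\<dots> = (\<Sum>e\<in>unit_steps. \<integral>y. h (e, y) \<partial>DY) / real (card unit_steps)"
    by (rule integral_pmf_of_set) (auto simp: unit_steps_def)
  also have "card unit_steps = 4"
    by (simp add: unit_steps_def)
  finally show ?thesis unfolding D h_def[symmetric] by (simp add: inner cong: sum.cong)
qed

text \<open>Finitely many steps are sampled, the remaining ones are averaged out in \<^const>\<open>zeros_gf\<close>;
  sampling one step more or less does not change the expectation.\<close>
lemma expectation_step:
  assumes "0 < \<epsilon>" "pi * \<epsilon>\<^sup>2 \<le> 1"
  shows "expectation (\<lambda>\<omega>. of_bool (interior_start \<epsilon> \<omega> \<and> avoids \<epsilon> (Suc n) \<omega>)
        * zeros_gf (1 - pi * \<epsilon>\<^sup>2) j (walk X (Suc n) \<omega>)) =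
    expectation (\<lambda>\<omega>. of_bool (interior_start \<epsilon> \<omega> \<and> avoids \<epsilon> n \<omega>)
        * zeros_gf (1 - pi * \<epsilon>\<^sup>2) (Suc j) (walk X n \<omega>))"
proof -
  let ?q = "1 - pi * \<epsilon>\<^sup>2"
  let ?I = "{\<epsilon><..<1 - \<epsilon>} \<times> {\<epsilon><..<1 - \<epsilon>} :: (real \<times> real) set"
  have q: "0 \<le> ?q" "?q \<le> 1" using assms by auto
  \<comment> \<open>A holds the past up to time n, including the start Y 0; B holds the fresh pair
    of time n + 1. The maps S, G and h below express the walk, the past event and the integrand
    through these blocks.\<close>
  define A where "A = Inl ` {1..n} \<union> Inr ` {0..n}"
  define B where "B = {Inl (Suc n), Inr (Suc n) :: nat + nat}"
  define W where "W C \<omega> = restrict (\<lambda>k. case_sum X Y k \<omega>) C" for C \<omega>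
  have ind: "indep_var (Pi\<^sub>M A (\<lambda>_. borel)) (W A) (Pi\<^sub>M B (\<lambda>_. borel)) (W B)"
    unfolding W_def by (rule indep_var_restrict[OF indep_vars_XY]) (auto simp: A_def B_def)
  define S where "S m r = (\<Sum>i=1..m. r (Inl i))" for m and r :: "nat + nat \<Rightarrow> real \<times> real"
  define G where "G r \<longleftrightarrow> r (Inr 0) \<in> ?I \<and> (\<forall>m\<in>{1..n}. \<not> norm (S m r + r (Inr m) - r (Inr 0)) < \<epsilon>)" for r
  define h where "h z = of_bool (G (fst z) \<and>
      \<not> norm (S n (fst z) + fst (snd z) + snd (snd z) - fst z (Inr 0)) < \<epsilon>)
      * zeros_gf ?q j (S n (fst z) + fst (snd z))"
    for z :: "(nat + nat \<Rightarrow> real \<times> real) \<times> (real \<times> real) \<times> real \<times> real"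
  have comp: "(\<lambda>r. r k) \<in> borel_measurable (Pi\<^sub>M A (\<lambda>_. borel))" if "k \<in> A"
    for k by (rule measurable_component_singleton[OF that])
  have mS: "S m \<in> borel_measurable (Pi\<^sub>M A (\<lambda>_. borel))" if "m \<le> n" for m
    unfolding S_def[abs_def] using that by (intro borel_measurable_sum comp) (auto simp: A_def)
  have mY: "(\<lambda>r. r (Inr m)) \<in> borel_measurable (Pi\<^sub>M A (\<lambda>_. borel))" if "m \<le> n" for m
    using that by (intro comp) (auto simp: A_def)
  have [measurable]: "(\<lambda>r. r (Inr 0)) \<in> borel_measurable (Pi\<^sub>M A (\<lambda>_. borel))"
    "S n \<in> borel_measurable (Pi\<^sub>M A (\<lambda>_. borel))"
    by (simp_all add: mY mS)
  have "{r \<in> space (Pi\<^sub>M A (\<lambda>_. borel)). \<forall>m\<in>{1..n}. \<not> norm (S m r + r (Inr m) - r (Inr 0)) < \<epsilon>}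
      \<in> sets (Pi\<^sub>M A (\<lambda>_. borel))"
  proof (rule sets.sets_Collect_finite_All)
    fix m assume "m \<in> {1..n}"
    then have [measurable]: "S m \<in> borel_measurable (Pi\<^sub>M A (\<lambda>_. borel))"
      "(\<lambda>r. r (Inr m)) \<in> borel_measurable (Pi\<^sub>M A (\<lambda>_. borel))"
      by (simp_all add: mY mS)
    show "{r \<in> space (Pi\<^sub>M A (\<lambda>_. borel)). \<not> norm (S m r + r (Inr m) - r (Inr 0)) < \<epsilon>}
        \<in> sets (Pi\<^sub>M A (\<lambda>_. borel))"
      by measurable
  qed simp
  then have [measurable]: "Measurable.pred (Pi\<^sub>M A (\<lambda>_. borel))
      (\<lambda>r. \<forall>m\<in>{1..n}. \<not> norm (S m r + r (Inr m) - r (Inr 0)) < \<epsilon>)"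
    by (simp add: pred_def)
  have [measurable]: "Measurable.pred (Pi\<^sub>M A (\<lambda>_. borel)) G"
    unfolding G_def[abs_def] by measurable
  have h_meas: "h \<in> borel_measurable (Pi\<^sub>M A (\<lambda>_. borel) \<Otimes>\<^sub>M (borel \<Otimes>\<^sub>M borel))"
    unfolding h_def of_bool_def by measurable
  have gf: "\<bar>zeros_gf ?q j x\<bar> \<le> 1" for x using zeros_gf_bounds[OF q, of j x] by simp
  have hb: "\<bar>h z\<bar> \<le> 1" for z unfolding h_def using gf by (simp add: abs_mult)
  have g: "(\<lambda>r. (r (Inl (Suc n)), r (Inr (Suc n)))) \<in> measurable (Pi\<^sub>M B (\<lambda>_. borel)) (borel \<Otimes>\<^sub>M borel)"
    by (intro measurable_Pair measurable_component_singleton) (auto simp: B_def)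
  have SW: "S m (W A \<omega>) = walk X m \<omega>" if "m \<le> n" for m \<omega>
    unfolding S_def W_def walk_def using that by (intro sum.cong) (auto simp: A_def)
  have YW: "W A \<omega> (Inr m) = Y m \<omega>" if "m \<le> n" for m \<omega>
    using that by (auto simp: W_def A_def)
  have GW: "G (W A \<omega>) \<longleftrightarrow> interior_start \<epsilon> \<omega> \<and> avoids \<epsilon> n \<omega>" for \<omega>
    unfolding G_def interior_start_def avoids_def using SW YW
    by (auto simp: perturbed_walk_def walk_def[of X 0])
  have V: "(W B \<omega> (Inl (Suc n)), W B \<omega> (Inr (Suc n))) = (X (Suc n) \<omega>, Y (Suc n) \<omega>)" for \<omega>
    by (simp add: W_def B_def)
  have walk_Suc: "walk X (Suc n) \<omega> = walk X n \<omega> + X (Suc n) \<omega>" for \<omega> by (simp add: walk_def)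
  have "expectation (\<lambda>\<omega>. of_bool (interior_start \<epsilon> \<omega> \<and> avoids \<epsilon> (Suc n) \<omega>)
        * zeros_gf ?q j (walk X (Suc n) \<omega>)) =
      expectation (\<lambda>\<omega>. h (W A \<omega>, (X (Suc n) \<omega>, Y (Suc n) \<omega>)))"
    unfolding h_def by (simp add: SW YW GW avoids_Suc walk_Suc conj_assoc)
  also have "\<dots> = expectation (\<lambda>\<omega>. \<integral>v. h (W A \<omega>, v)
      \<partial>distr M (borel \<Otimes>\<^sub>M borel) (\<lambda>\<omega>. (X (Suc n) \<omega>, Y (Suc n) \<omega>)))"
    using expectation_indep_var[OF ind g h_meas hb] unfolding V .
  also have "\<dots> = expectation (\<lambda>\<omega>. of_bool (interior_start \<epsilon> \<omega> \<and> avoids \<epsilon> n \<omega>)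
        * zeros_gf ?q (Suc j) (walk X n \<omega>))"
  \<comment> \<open>Equality is only almost sure because \<open>integral_step\<close> needs the walk
    on the lattice.\<close>
  proof (rule integral_cong_AE)
    let ?D = "distr M (borel \<Otimes>\<^sub>M borel) (\<lambda>\<omega>. (X (Suc n) \<omega>, Y (Suc n) \<omega>))"
    interpret D: prob_space ?D by (rule prob_space_distr) measurable
    have WA [measurable]: "random_variable (Pi\<^sub>M A (\<lambda>_. borel)) (W A)"
      using indep_var_rv1[OF ind] .
    note h_meas [measurable]
    show "random_variable borel (\<lambda>\<omega>. \<integral>v. h (W A \<omega>, v) \<partial>?D)"
      by measurable
    show "random_variable borel (\<lambda>\<omega>. of_bool (interior_start \<epsilon> \<omega> \<and> avoids \<epsilon> n \<omega>)
        * zeros_gf ?q (Suc j) (walk X n \<omega>))"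
      unfolding of_bool_def by measurable
    show "AE \<omega> in M. (\<integral>v. h (W A \<omega>, v) \<partial>?D) =
        of_bool (interior_start \<epsilon> \<omega> \<and> avoids \<epsilon> n \<omega>) * zeros_gf ?q (Suc j) (walk X n \<omega>)"
      using AE_walk_lattice[of n]
    proof eventually_elim
      case (elim \<omega>)
      show ?case
      proof (cases "G (W A \<omega>)")
        case True
        then have "Y 0 \<omega> \<in> ?I" by (simp add: GW interior_start_def)
        from integral_step[OF assms(1) this elim, of "Suc n" "zeros_gf ?q j"] gf True True[unfolded GW]
        show ?thesis by (simp add: h_def SW YW)
      next
        \<comment> \<open>If the past event fails, both integrands vanish.\<close>
        case False
        then have "(interior_start \<epsilon> \<omega> \<and> avoids \<epsilon> n \<omega>) = False" by (simp only: GW)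
        then show ?thesis using False by (simp only: h_def fst_conv) simp
      qed
    qed
  qed
  finally show ?thesis .
qed

text \<open>Iterating \<open>expectation_step\<close> turns n sampled steps into n averaged ones; at
  time 0 nothing is left to avoid and the walk is at the origin.\<close>

lemma prob_avoids:
  assumes "0 < \<epsilon>" "pi * \<epsilon>\<^sup>2 \<le> 1"
  shows "prob {\<omega> \<in> space M. interior_start \<epsilon> \<omega> \<and> avoids \<epsilon> n \<omega>} =
    prob {\<omega> \<in> space M. interior_start \<epsilon> \<omega>} * zeros_gf (1 - pi * \<epsilon>\<^sup>2) n 0"
proof -
  have E: "expectation (\<lambda>\<omega>. of_bool (Q \<omega>) * c) = prob {\<omega> \<in> space M. Q \<omega>} * c"
    if [measurable]: "Measurable.pred M Q" for Q c
  proof -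
    have "expectation (\<lambda>\<omega>. of_bool (Q \<omega>) * c) = expectation (indicator {\<omega> \<in> space M. Q \<omega>}) * c"
      by (subst Bochner_Integration.integral_mult_left_zero[symmetric])
        (intro Bochner_Integration.integral_cong, auto simp: indicator_def)
    then show ?thesis by simp
  qed
  \<comment> \<open>The claim is for all j, since each induction step moves one unit from n to
    j.\<close>
  have "expectation (\<lambda>\<omega>. of_bool (interior_start \<epsilon> \<omega> \<and> avoids \<epsilon> n \<omega>)
        * zeros_gf (1 - pi * \<epsilon>\<^sup>2) j (walk X n \<omega>)) =
      prob {\<omega> \<in> space M. interior_start \<epsilon> \<omega>} * zeros_gf (1 - pi * \<epsilon>\<^sup>2) (n + j) 0" for j
  proof (induction n arbitrary: j)
    case 0
    have "avoids \<epsilon> 0 \<omega>" "walk X 0 \<omega> = 0" for \<omega> by (simp_all add: avoids_def walk_def)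
    then show ?case using E[OF measurable_interior_start] by simp
  next
    case (Suc n)
    show ?case using Suc.IH[of "Suc j"] unfolding expectation_step[OF assms] add_Suc_shift .
  qed
  from this[of 0] show ?thesis
    using E[of "\<lambda>\<omega>. interior_start \<epsilon> \<omega> \<and> avoids \<epsilon> n \<omega>" 1] by simp
qed

section \<open>Return events and the limit law\<close>

lemma prob_interior_start:
  assumes "0 < \<epsilon>" "\<epsilon> < 1 / 2"
  shows "prob {\<omega> \<in> space M. interior_start \<epsilon> \<omega>} = (1 - 2 * \<epsilon>)\<^sup>2"
proof -
  let ?I = "{\<epsilon><..<1 - \<epsilon>} \<times> {\<epsilon><..<1 - \<epsilon>} :: (real \<times> real) set"
  have "prob {\<omega> \<in> space M. interior_start \<epsilon> \<omega>} = measure (distr M borel (Y 0)) ?I"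
    by (subst measure_distr) (auto simp: interior_start_def intro!: arg_cong[where f = prob])
  also have "\<dots> = measure lborel (({0<..<1} \<times> {0<..<1}) \<inter> ?I)"
    unfolding distr_Y0 using measure_square[of 0 1] emeasure_eq_ennreal_measure[of lborel "{0<..<1} \<times> {0<..<1 :: real}"]
    by (subst measure_uniform_measure) (auto simp: measure_def)
  also have "({0<..<1} \<times> {0<..<1}) \<inter> ?I = ?I"
    using assms by auto
  also have "measure lborel \<dots> = (1 - 2 * \<epsilon>)\<^sup>2"
    using assms measure_square[of \<epsilon> "1 - \<epsilon>"] by simp
  finally show ?thesis .
qed

text \<open>The ball has the constant measure p = \<open>pi * \<epsilon>\<^sup>2\<close>, and p ln m
  \<le> t means m \<le> exp (t / p), which for integers m may be rounded down.\<close>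

lemma return_event_eq:
  assumes "0 < \<epsilon>" "0 \<le> t"
  shows "{\<omega> \<in> space M. ereal (measure lborel (ball (perturbed_walk X Y 0 \<omega>) \<epsilon>))
              * ln_enat (return_time (perturbed_walk X Y) \<epsilon> \<omega>) \<le> ereal t} =
    {\<omega> \<in> space M. \<not> avoids \<epsilon> (nat \<lfloor>exp (t / (pi * \<epsilon>\<^sup>2))\<rfloor>) \<omega>}"
proof -
  define p where "p = pi * \<epsilon>\<^sup>2"
  have p: "p > 0" using assms by (simp add: p_def)
  define N where "N = nat \<lfloor>exp (t / p)\<rfloor>"
  have "ereal p * ln_enat (return_time (perturbed_walk X Y) \<epsilon> \<omega>) \<le> ereal t \<longleftrightarrow> \<not> avoids \<epsilon> N \<omega>" for \<omega>
  proof -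
    define R where "R = {m. m \<ge> 1 \<and> norm (perturbed_walk X Y m \<omega> - perturbed_walk X Y 0 \<omega>) < \<epsilon>}"
    have rt: "return_time (perturbed_walk X Y) \<epsilon> \<omega> = Inf (enat ` R)"
      unfolding return_time_def R_def by (intro arg_cong[where f = Inf]) auto
    have av: "\<not> avoids \<epsilon> N \<omega> \<longleftrightarrow> (\<exists>m\<in>R. m \<le> N)"
      unfolding avoids_def R_def by auto
    show ?thesis
    proof (cases "R = {}")
      case True
      \<comment> \<open>Without a return the time is infinite, and p > 0 makes the product infinite,
        so the inequality fails.\<close>
      then show ?thesis using p by (auto simp: rt av ln_enat_def top_enat_def)
    next
      case False
      define m where "m = (LEAST m. m \<in> R)"
      have m: "m \<in> R" "\<And>k. k \<in> R \<Longrightarrow> m \<le> k"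
        unfolding m_def using False by (auto intro: LeastI Least_le)
      have "Inf (enat ` R) = enat m"
        using m by (intro antisym Inf_lower Inf_greatest) auto
      then have "ereal p * ln_enat (return_time (perturbed_walk X Y) \<epsilon> \<omega>) \<le> ereal t \<longleftrightarrow> p * ln (real m) \<le> t"
        by (simp add: rt ln_enat_def)
      also have "\<dots> \<longleftrightarrow> ln (real m) \<le> t / p"
        using p by (simp add: pos_le_divide_eq mult.commute)
      also have "\<dots> \<longleftrightarrow> real m \<le> exp (t / p)"
      proof -
        have "real m > 0" using m(1) by (simp add: R_def)
        then have "exp (ln (real m)) = real m" by simp
        then show ?thesis by (metis exp_le_cancel_iff)
      qed
      also have "\<dots> \<longleftrightarrow> m \<le> N"
        unfolding N_def by (simp add: le_nat_floor nat_le_iff le_nat_iff le_floor_iff)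
      also have "\<dots> \<longleftrightarrow> (\<exists>m\<in>R. m \<le> N)"
        using m order_trans by blast
      finally show ?thesis by (simp add: av)
    qed
  qed
  then show ?thesis
    using assms by (simp add: measure_ball_plane p_def[symmetric] N_def)
qed

lemma return_time_limit:
  assumes "t \<ge> 0"
  shows "((\<lambda>\<epsilon>. measure M {\<omega> \<in> space M.
            ereal (measure lborel (ball (perturbed_walk X Y 0 \<omega>) \<epsilon>))
              * ln_enat (return_time (perturbed_walk X Y) \<epsilon> \<omega>) \<le> ereal t})
          \<longlongrightarrow> (if t = 0 then 0 else 1 / (1 + pi / t))) (at_right 0)"
proof -
  define w where "w \<epsilon> = zeros_gf (1 - pi * \<epsilon>\<^sup>2) (nat \<lfloor>exp (t / (pi * \<epsilon>\<^sup>2))\<rfloor>) 0" for \<epsilon>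
  let ?f = "\<lambda>\<epsilon>. measure M {\<omega> \<in> space M.
            ereal (measure lborel (ball (perturbed_walk X Y 0 \<omega>) \<epsilon>))
              * ln_enat (return_time (perturbed_walk X Y) \<epsilon> \<omega>) \<le> ereal t}"
  have p0: "((\<lambda>\<epsilon>::real. pi * \<epsilon>\<^sup>2) \<longlongrightarrow> 0) (at_right 0)"
    by (rule tendsto_eq_intros refl | simp)+
  have a1: "((\<lambda>\<epsilon>::real. (1 - 2 * \<epsilon>)\<^sup>2) \<longlongrightarrow> 1) (at_right 0)"
    by (rule tendsto_eq_intros refl | simp)+
  have pos: "eventually (\<lambda>\<epsilon>::real. 0 < \<epsilon>) (at_right 0)"
    by (rule eventually_at_right_less)
  have w: "(w \<longlongrightarrow> 1 / (1 + t / pi)) (at_right 0)"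
    unfolding w_def using p0 assms pos
    by (intro zeros_gf_limit) (auto elim: eventually_mono)
  have ev: "eventually (\<lambda>\<epsilon>::real. 0 < \<epsilon> \<and> \<epsilon> < 1 / 2 \<and> pi * \<epsilon>\<^sup>2 \<le> 1) (at_right 0)"
  proof -
    have "eventually (\<lambda>\<epsilon>::real. \<epsilon> < 1 / 2) (at_right 0)"
      by (rule order_tendstoD(2)[OF tendsto_ident_at]) simp
    moreover have "eventually (\<lambda>\<epsilon>::real. pi * \<epsilon>\<^sup>2 < 1) (at_right 0)"
      by (rule order_tendstoD(2)[OF p0]) simp
    ultimately show ?thesis using pos by eventually_elim simp
  qed
  \<comment> \<open>Ignoring boundary starts changes the probability by at most that of the boundary
    strip, 1 - (1 - 2\<epsilon>)^2, which vanishes with \<epsilon>.\<close>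
  have bounds: "1 - (1 - 2 * \<epsilon>)\<^sup>2 * w \<epsilon> - (1 - (1 - 2 * \<epsilon>)\<^sup>2) \<le> ?f \<epsilon> \<and> ?f \<epsilon> \<le> 1 - (1 - 2 * \<epsilon>)\<^sup>2 * w \<epsilon>"
    if "0 < \<epsilon> \<and> \<epsilon> < 1 / 2 \<and> pi * \<epsilon>\<^sup>2 \<le> 1" for \<epsilon>
  proof -
    define N where "N = nat \<lfloor>exp (t / (pi * \<epsilon>\<^sup>2))\<rfloor>"
    let ?A = "{\<omega> \<in> space M. avoids \<epsilon> N \<omega>}"
    let ?IA = "{\<omega> \<in> space M. interior_start \<epsilon> \<omega> \<and> avoids \<epsilon> N \<omega>}"
    let ?I = "{\<omega> \<in> space M. interior_start \<epsilon> \<omega>}"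
    have "?f \<epsilon> = prob (space M - ?A)"
      using that assms by (subst return_event_eq) (auto simp: N_def intro!: arg_cong[where f = prob])
    also have "\<dots> = 1 - prob ?A" by (rule prob_compl) measurable
    finally have f: "?f \<epsilon> = 1 - prob ?A" .
    have IA: "prob ?IA = (1 - 2 * \<epsilon>)\<^sup>2 * w \<epsilon>"
      using that prob_avoids[of \<epsilon> N] prob_interior_start[of \<epsilon>] by (simp add: w_def N_def)
    have "prob ?IA \<le> prob ?A" by (intro finite_measure_mono) auto
    moreover have "prob ?A \<le> prob (?IA \<union> (space M - ?I))" by (intro finite_measure_mono) auto
    moreover have "prob (?IA \<union> (space M - ?I)) \<le> prob ?IA + prob (space M - ?I)"
      by (intro measure_Un_le) auto
    moreover have "prob (space M - ?I) = 1 - (1 - 2 * \<epsilon>)\<^sup>2"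
      using that prob_interior_start[of \<epsilon>] by (subst prob_compl) auto
    ultimately show ?thesis unfolding f IA by linarith
  qed
  \<comment> \<open>Both sides are t / (pi + t). The case t = 0 is separate because
    \<open>pi / 0\<close> is 0, which would make the formula give 1.\<close>
  have lim: "1 - 1 / (1 + t / pi) = (if t = 0 then 0 else 1 / (1 + pi / t))"
    using assms add_pos_nonneg[OF pi_gt_zero assms] by (auto simp: divide_simps)
  show ?thesis
  proof (rule tendsto_sandwich)
    show "eventually (\<lambda>\<epsilon>. 1 - (1 - 2 * \<epsilon>)\<^sup>2 * w \<epsilon> - (1 - (1 - 2 * \<epsilon>)\<^sup>2) \<le> ?f \<epsilon>) (at_right 0)"
      using ev by eventually_elim (use bounds in blast)
    show "eventually (\<lambda>\<epsilon>. ?f \<epsilon> \<le> 1 - (1 - 2 * \<epsilon>)\<^sup>2 * w \<epsilon>) (at_right 0)"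
      using ev by eventually_elim (use bounds in blast)
    have "((\<lambda>\<epsilon>. 1 - (1 - 2 * \<epsilon>)\<^sup>2 * w \<epsilon>) \<longlongrightarrow> 1 - 1 * (1 / (1 + t / pi))) (at_right 0)"
      by (intro tendsto_intros a1 w)
    then show "((\<lambda>\<epsilon>. 1 - (1 - 2 * \<epsilon>)\<^sup>2 * w \<epsilon>) \<longlongrightarrow> (if t = 0 then 0 else 1 / (1 + pi / t))) (at_right 0)"
      using lim by simp
    have "((\<lambda>\<epsilon>. 1 - (1 - 2 * \<epsilon>)\<^sup>2 * w \<epsilon> - (1 - (1 - 2 * \<epsilon>)\<^sup>2))
        \<longlongrightarrow> 1 - 1 * (1 / (1 + t / pi)) - (1 - 1)) (at_right 0)"
      by (intro tendsto_intros a1 w)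
    then show "((\<lambda>\<epsilon>. 1 - (1 - 2 * \<epsilon>)\<^sup>2 * w \<epsilon> - (1 - (1 - 2 * \<epsilon>)\<^sup>2))
        \<longlongrightarrow> (if t = 0 then 0 else 1 / (1 + pi / t))) (at_right 0)"
      using lim by simp
  qed
qed

end

theorem theorem2:
  fixes P :: "'a measure" and X Y :: "nat \<Rightarrow> 'a \<Rightarrow> real \<times> real" and t :: real
  assumes "prob_space P"
    and "prob_space.iid_vars P borel X {1..}"
    and "prob_space.iid_vars P borel Y UNIV"
    and "prob_space.indep_seqs P borel X {1..} borel Y UNIV"
    and "distr P borel (X 1) = distr (measure_pmf (pmf_of_set unit_steps)) borel (\<lambda>x. x)"
    and "distr P borel (Y 0) = uniform_measure lborel ({0<..<1} \<times> {0<..<1})"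
    and "t \<ge> 0"
  shows "((\<lambda>\<epsilon>. measure P {\<omega> \<in> space P.
            ereal (measure lborel (ball (perturbed_walk X Y 0 \<omega>) \<epsilon>))
              * ln_enat (return_time (perturbed_walk X Y) \<epsilon> \<omega>) \<le> ereal t})
          \<longlongrightarrow> (if t = 0 then 0 else 1 / (1 + pi / t))) (at_right 0)"
proof -
  interpret prob_space P by fact
  interpret perturbed_srw P X Y by unfold_locales (fact assms)+
  show ?thesis by (rule return_time_limit) fact
qed

end
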